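(* Let $\ell$ be an integer with $\ell\equiv -1\bmod 3$. Then $J_3(1+3\ell)\cong J_3(7)$, and hence $H_3(1+3\ell)\cong H_3(7)$ and $K_3(1+3\ell)\cong K_3(7)$, where the groups are those defined in the context.
   Context: Conventions: $[a,b]=a^{-1}b^{-1}ab$ and $b^a=a^{-1}ba$. For a group $T$, $Z(T)=Z_1(T)$ is its center and $Z_2(T)/Z_1(T)$ is the center of $T/Z_1(T)$. For $\alpha=1+3\ell$ with $\ell\equiv -1\bmod 3$, $$J_3(\alpha)=\langle x,y\mid x^{[x,y]}=x^{\alpha},\ y^{[y,x]}=y^{\alpha},\ x^{81}=y^{81}=1\rangle,$$ $H_3(\alpha)=J_3(\alpha)/Z(J_3(\alpha))$ and $K_3(\alpha)=J_3(\alpha)/Z_2(J_3(\alpha))$. *)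

theory Defs
  imports "HOL-Algebra.Algebra" "HOL-Number_Theory.Cong"
begin

section \<open>Free groups\<close>

text \<open>A word is a list of letters \<open>(a, e)\<close>, where \<open>(a, True)\<close> stands for the generator
  \<open>a\<close> and \<open>(a, False)\<close> for its formal inverse. The free group on \<^typ>\<open>'a\<close> consists of the
  words modulo the equivalence relation generated by deleting a subword \<open>a a\<^sup>-\<^sup>1\<close> or \<open>a\<^sup>-\<^sup>1 a\<close>.\<close>

type_synonym 'a word = "('a \<times> bool) list"

inductive cancel_step :: "'a word \<Rightarrow> 'a word \<Rightarrow> bool" where
  "cancel_step (u @ [(a, e), (a, \<not> e)] @ v) (u @ v)"

definition word_eq :: "'a word \<Rightarrow> 'a word \<Rightarrow> bool" where
  "word_eq = equivclp cancel_step"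

definition word_inv :: "'a word \<Rightarrow> 'a word" where
  "word_inv w = rev (map (\<lambda>(a, e). (a, \<not> e)) w)"

lemma equivp_word_eq: "equivp word_eq"
  by (simp add: word_eq_def)

lemma word_eq_refl [simp, intro]: "word_eq w w"
  by (simp add: equivp_reflp[OF equivp_word_eq])

lemma word_eq_sym: "word_eq u v \<Longrightarrow> word_eq v u"
  by (rule equivp_symp[OF equivp_word_eq])

lemma word_eq_trans: "word_eq u v \<Longrightarrow> word_eq v w \<Longrightarrow> word_eq u w"
  by (rule equivp_transp[OF equivp_word_eq])

lemma word_eq_step: "cancel_step u v \<Longrightarrow> word_eq u v"
  unfolding word_eq_def by (rule r_into_equivclp)

lemma word_eq_induct [consumes 1, case_names refl step sym trans]:
  assumes "word_eq u v"
    and "\<And>u. P u u"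
    and "\<And>u v. cancel_step u v \<Longrightarrow> P u v"
    and "\<And>u v. P u v \<Longrightarrow> P v u"
    and "\<And>u v w. P u v \<Longrightarrow> P v w \<Longrightarrow> P u w"
  shows "P u v"
  using assms(1) unfolding word_eq_def
proof (induction rule: equivclp_induct)
  case base
  show ?case by (rule assms(2))
next
  case (step y z)
  then show ?case using assms(3-5) by blast
qed

lemma word_eq_append_right: "word_eq u v \<Longrightarrow> word_eq (u @ w) (v @ w)"
proof (induction rule: word_eq_induct)
  case (step u v)
  then show ?case
  proof cases
    case (1 p a e q)
    then show ?thesis
      using cancel_step.intros[of p a e "q @ w"] by (simp add: word_eq_step)
  qed
qed (auto intro: word_eq_sym word_eq_trans)

lemma word_eq_append_left: "word_eq u v \<Longrightarrow> word_eq (w @ u) (w @ v)"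
proof (induction rule: word_eq_induct)
  case (step u v)
  then show ?case
  proof cases
    case (1 p a e q)
    then show ?thesis
      using cancel_step.intros[of "w @ p" a e q] by (simp add: word_eq_step)
  qed
qed (auto intro: word_eq_sym word_eq_trans)

lemma word_eq_append: "word_eq u u' \<Longrightarrow> word_eq v v' \<Longrightarrow> word_eq (u @ v) (u' @ v')"
  by (blast intro: word_eq_append_left word_eq_append_right word_eq_trans)

lemma word_eq_inv_append: "word_eq (word_inv w @ w) []"
proof (induction w)
  case (Cons l w)
  obtain a e where l: "l = (a, e)" by (cases l)
  have "cancel_step (word_inv w @ [(a, \<not> e), (a, \<not> \<not> e)] @ w) (word_inv w @ w)"
    by (rule cancel_step.intros)
  then have "word_eq (word_inv (l # w) @ l # w) (word_inv w @ w)"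
    by (simp add: l word_inv_def word_eq_step)
  then show ?case using Cons.IH word_eq_trans by blast
qed (simp add: word_inv_def)

quotient_type 'a free_elem = "'a word" / word_eq
  by (rule equivp_word_eq)

lift_definition free_mult :: "'a free_elem \<Rightarrow> 'a free_elem \<Rightarrow> 'a free_elem" is "(@)"
  by (rule word_eq_append)

lift_definition free_one :: "'a free_elem" is "[]" .

lift_definition free_gen :: "'a \<Rightarrow> 'a free_elem" is "\<lambda>a. [(a, True)]" .

definition free_group :: "'a free_elem monoid" where
  "free_group = \<lparr>carrier = UNIV, monoid.mult = free_mult, one = free_one\<rparr>"

lemma group_free_group: "group (free_group :: 'a free_elem monoid)"
proof (rule groupI)
  fix x y z :: "'a free_elem"
  show "x \<otimes>\<^bsub>free_group\<^esub> y \<otimes>\<^bsub>free_group\<^esub> z = x \<otimes>\<^bsub>free_group\<^esub> (y \<otimes>\<^bsub>free_group\<^esub> z)"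
    unfolding free_group_def by simp (transfer, simp)
  show "\<one>\<^bsub>free_group\<^esub> \<otimes>\<^bsub>free_group\<^esub> x = x"
    unfolding free_group_def by simp (transfer, simp)
  have "\<exists>y. free_mult y x = free_one"
    by transfer (blast intro: word_eq_inv_append)
  then show "\<exists>y\<in>carrier free_group. y \<otimes>\<^bsub>free_group\<^esub> x = \<one>\<^bsub>free_group\<^esub>"
    by (simp add: free_group_def)
qed (simp_all add: free_group_def)


section \<open>Presentations\<close>

definition normal_closure :: "('a, 'b) monoid_scheme \<Rightarrow> 'a set \<Rightarrow> 'a set" where
  "normal_closure G R = \<Inter> {N. N \<lhd> G \<and> R \<subseteq> N}"

definition presented_group :: "'a free_elem set \<Rightarrow> 'a free_elem set monoid" where
  "presented_group R = free_group Mod normal_closure free_group R"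

lemma (in group) normal_normal_closure:
  assumes "R \<subseteq> carrier G"
  shows "normal_closure G R \<lhd> G"
proof -
  let ?S = "{N. N \<lhd> G \<and> R \<subseteq> N}"
  have ne: "?S \<noteq> {}"
    using normal_invI[OF subgroup_self] assms by fastforce
  have "subgroup (\<Inter> ?S) G"
    using ne by (intro subgroups_Inter) (auto simp: normal_def)
  then show ?thesis
    unfolding normal_closure_def
    by (rule normal_invI) (auto dest: normal.inv_op_closed2)
qed

lemma group_presented_group: "group (presented_group R)"
  unfolding presented_group_def
  by (intro normal.factorgroup_is_group group.normal_normal_closure group_free_group)
     (simp add: free_group_def)


section \<open>Centers\<close>

definition center :: "('a, 'b) monoid_scheme \<Rightarrow> 'a set" where
  "center G = {z \<in> carrier G. \<forall>g \<in> carrier G. z \<otimes>\<^bsub>G\<^esub> g = g \<otimes>\<^bsub>G\<^esub> z}"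

definition second_center :: "('a, 'b) monoid_scheme \<Rightarrow> 'a set" where
  "second_center G =
     {z \<in> carrier G. center G #>\<^bsub>G\<^esub> z \<in> center (G Mod center G)}"

lemma (in group) normal_center: "center G \<lhd> G"
proof (rule normal_invI)
  show "subgroup (center G) G"
  proof
    fix x y assume xy: "x \<in> center G" "y \<in> center G"
    then have carr: "x \<in> carrier G" "y \<in> carrier G" by (simp_all add: center_def)
    have "x \<otimes> y \<otimes> g = g \<otimes> (x \<otimes> y)" if g: "g \<in> carrier G" for g
    proof -
      have "x \<otimes> y \<otimes> g = x \<otimes> (y \<otimes> g)" using carr g by (rule m_assoc)
      also have "y \<otimes> g = g \<otimes> y" using xy g by (simp add: center_def)
      also have "x \<otimes> (g \<otimes> y) = x \<otimes> g \<otimes> y" using carr g by (simp add: m_assoc)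
      also have "x \<otimes> g = g \<otimes> x" using xy g by (simp add: center_def)
      also have "g \<otimes> x \<otimes> y = g \<otimes> (x \<otimes> y)" using carr g by (simp add: m_assoc)
      finally show ?thesis .
    qed
    with carr show "x \<otimes> y \<in> center G" by (simp add: center_def)
    have "inv x \<otimes> g = g \<otimes> inv x" if g: "g \<in> carrier G" for g
    proof -
      have "inv x \<otimes> g = inv (inv g \<otimes> x)" using carr g by (simp add: inv_mult_group)
      also have "inv g \<otimes> x = x \<otimes> inv g" using xy g by (simp add: center_def)
      also have "inv (x \<otimes> inv g) = g \<otimes> inv x" using carr g by (simp add: inv_mult_group)
      finally show ?thesis .
    qed
    with carr show "inv x \<in> center G" by (simp add: center_def)
  qed (auto simp: center_def)
next
  fix x h assume xh: "x \<in> carrier G" "h \<in> center G"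
  then have "x \<otimes> h \<otimes> inv x = h \<otimes> x \<otimes> inv x" and "h \<in> carrier G"
    by (simp_all add: center_def)
  with xh(1) have "x \<otimes> h \<otimes> inv x = h"
    by (simp add: m_assoc)
  with xh show "x \<otimes> h \<otimes> inv x \<in> center G" by simp
qed

lemma (in group) normal_second_center: "second_center G \<lhd> G"
proof -
  interpret C: normal "center G" G by (rule normal_center)
  interpret Q: group "G Mod center G" by (rule C.factorgroup_is_group)
  interpret h: group_hom G "G Mod center G" "\<lambda>a. center G #> a"
    by unfold_locales (rule C.r_coset_hom_Mod)
  interpret CQ: normal "center (G Mod center G)" "G Mod center G" by (rule Q.normal_center)
  have eq: "second_center G = {z \<in> carrier G. center G #> z \<in> center (G Mod center G)}"
    by (simp add: second_center_def)
  have one: "center G #> \<one> \<in> center (G Mod center G)"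
    using CQ.one_closed h.hom_one by simp
  have mult: "center G #> (a \<otimes> b) \<in> center (G Mod center G)"
    if "a \<in> second_center G" "b \<in> second_center G" for a b
    using that CQ.m_closed h.hom_mult[of a b] by (simp add: eq del: mult_FactGroup)
  show ?thesis
  proof (rule normal_invI)
    show "subgroup (second_center G) G"
      by (rule subgroupI) (use one mult in \<open>auto simp: eq\<close>)
  next
    fix x h assume "x \<in> carrier G" "h \<in> second_center G"
    then show "x \<otimes> h \<otimes> inv x \<in> second_center G"
      using CQ.inv_op_closed2[of "center G #> x" "center G #> h"] h.hom_closed[of x]
      by (simp add: eq)
  qed
qed


section \<open>The groups\<close>

definition commutator :: "('a, 'b) monoid_scheme \<Rightarrow> 'a \<Rightarrow> 'a \<Rightarrow> 'a" where
  "commutator G a b = inv\<^bsub>G\<^esub> a \<otimes>\<^bsub>G\<^esub> inv\<^bsub>G\<^esub> b \<otimes>\<^bsub>G\<^esub> a \<otimes>\<^bsub>G\<^esub> b"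

text \<open>\<open>conj_by G b a\<close> is \<open>b\<^sup>a\<close>: the element \<open>b\<close> conjugated by \<open>a\<close>.\<close>

definition conj_by :: "('a, 'b) monoid_scheme \<Rightarrow> 'a \<Rightarrow> 'a \<Rightarrow> 'a" where
  "conj_by G b a = inv\<^bsub>G\<^esub> a \<otimes>\<^bsub>G\<^esub> b \<otimes>\<^bsub>G\<^esub> a"

datatype gen_xy = Gen_x | Gen_y

text \<open>A relation \<open>u = v\<close> is encoded by the relator \<open>u v\<^sup>-\<^sup>1\<close>. The exponent \<open>\<alpha>\<close> may be negative.\<close>

definition J3_relators :: "int \<Rightarrow> gen_xy free_elem set" where
  "J3_relators \<alpha> =
     (let F = free_group; x = free_gen Gen_x; y = free_gen Gen_y in
       {conj_by F x (commutator F x y) \<otimes>\<^bsub>F\<^esub> inv\<^bsub>F\<^esub> (x [^]\<^bsub>F\<^esub> \<alpha>),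
        conj_by F y (commutator F y x) \<otimes>\<^bsub>F\<^esub> inv\<^bsub>F\<^esub> (y [^]\<^bsub>F\<^esub> \<alpha>),
        x [^]\<^bsub>F\<^esub> (81::nat),
        y [^]\<^bsub>F\<^esub> (81::nat)})"

definition J3 :: "int \<Rightarrow> gen_xy free_elem set monoid" where
  "J3 \<alpha> = presented_group (J3_relators \<alpha>)"

definition H3 :: "int \<Rightarrow> gen_xy free_elem set set monoid" where
  "H3 \<alpha> = J3 \<alpha> Mod center (J3 \<alpha>)"

definition K3 :: "int \<Rightarrow> gen_xy free_elem set set monoid" where
  "K3 \<alpha> = J3 \<alpha> Mod second_center (J3 \<alpha>)"

end

theory Submission
  imports Defs
begin

text \<open>Let \<open>x, y\<close> satisfy the relations of \<open>J\<^sub>3(\<alpha>)\<close> with \<open>\<alpha> \<equiv> 7\<close> modulo \<open>9\<close>, and put \<open>c = [x, y]\<close>.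
  Since \<open>y\<^sup>x = y c\<^sup>-\<^sup>1\<close>, one gets \<open>[x, y\<^sup>b] = y\<^sup>m c\<^sup>b\<close> with an explicit integer \<open>m\<close>, which is a multiple
  of \<open>27\<close> when \<open>b = 4\<close>. Computing \<open>[x\<^sup>4, y\<^sup>4]\<close> from both sides yields \<open>x\<^sup>2\<^sup>7 y\<^sup>2\<^sup>7 = 1\<close>, so that
  \<open>y\<^sup>2\<^sup>7\<close> commutes with \<open>x\<close>. Hence \<open>[x, y\<^sup>4]\<close> acts on \<open>x\<close> as \<open>c\<^sup>4\<close> does, and \<open>(x, y\<^sup>4)\<close> satisfies the
  relations of \<open>J\<^sub>3(\<alpha>\<^sup>4)\<close>. As \<open>4\<close> has order \<open>27\<close> modulo \<open>81\<close>, the resulting homomorphisms are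
  invertible, and the iterated fourth powers of \<open>7\<close> exhaust the residues modulo \<open>81\<close> that are
  \<open>7\<close> modulo \<open>9\<close>.\<close>

section \<open>Conjugation and commutators\<close>

lemma (in group) conj_by_closed [simp]:
  "a \<in> carrier G \<Longrightarrow> b \<in> carrier G \<Longrightarrow> conj_by G b a \<in> carrier G"
  by (simp add: conj_by_def)

lemma (in group) conj_by_eq_iff:
  assumes "a \<in> carrier G" "b \<in> carrier G" "d \<in> carrier G"
  shows "conj_by G b a = d \<longleftrightarrow> b \<otimes> a = a \<otimes> d"
proof -
  have "conj_by G b a = inv a \<otimes> (b \<otimes> a)"
    using assms by (simp add: conj_by_def m_assoc)
  then show ?thesis
    using assms by (metis inv_solve_left m_closed)
qed

lemma (in group) conj_by_mult:
  assumes "a \<in> carrier G" "b \<in> carrier G" "b' \<in> carrier G"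
  shows "conj_by G (b \<otimes> b') a = conj_by G b a \<otimes> conj_by G b' a"
proof -
  have "a \<otimes> (inv a \<otimes> t) = t" if "t \<in> carrier G" for t
    using assms that by (simp flip: m_assoc)
  then show ?thesis
    using assms by (simp add: conj_by_def m_assoc)
qed

text \<open>Gives the rules for inverses and integer powers. Commuting with a is being fixed by this
  map, so it passes to powers too.\<close>

lemma (in group) conj_by_hom:
  assumes "a \<in> carrier G"
  shows "group_hom G G (\<lambda>b. conj_by G b a)"
  using assms by unfold_locales (auto simp: hom_def conj_by_mult)

lemma (in group) conj_by_int_pow:
  assumes "a \<in> carrier G" "b \<in> carrier G"
  shows "conj_by G (b [^] (i::int)) a = conj_by G b a [^] i"
  using group_hom.hom_int_pow[OF conj_by_hom] assms by blast

lemma (in group) conj_by_inv: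
  assumes "a \<in> carrier G" "b \<in> carrier G"
  shows "conj_by G (inv b) a = inv (conj_by G b a)"
  using group_hom.hom_inv[OF conj_by_hom] assms by blast

lemma (in group) conj_by_conj_by:
  assumes "a \<in> carrier G" "a' \<in> carrier G" "b \<in> carrier G"
  shows "conj_by G (conj_by G b a) a' = conj_by G b (a \<otimes> a')"
  using assms by (simp add: conj_by_def m_assoc inv_mult_group)

lemma (in group) conj_by_one [simp]: "b \<in> carrier G \<Longrightarrow> conj_by G b \<one> = b"
  by (simp add: conj_by_def)

lemma (in group) inv_commutator:
  assumes "a \<in> carrier G" "b \<in> carrier G"
  shows "inv (commutator G a b) = commutator G b a"
  using assms by (simp add: commutator_def inv_mult_group m_assoc)

lemma (in group) commutator_closed [simp]:
  "a \<in> carrier G \<Longrightarrow> b \<in> carrier G \<Longrightarrow> commutator G a b \<in> carrier G"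
  by (simp add: commutator_def)

lemma (in group) int_pow_cong:
  assumes "a \<in> carrier G" "a [^] (n::nat) = \<one>" "[i = j] (mod int n)"
  shows "a [^] (i::int) = a [^] j"
proof -
  obtain k where "i = j + int n * k"
    using assms(3) by (metis cong_iff_lin cong_sym)
  moreover have "a [^] (int n * k) = \<one>"
    using assms by (simp add: int_pow_int flip: int_pow_pow)
  ultimately show ?thesis
    using assms by (simp add: int_pow_mult)
qed

text \<open>Moving all factors \<open>s\<close> to the right in \<open>(g s)\<^sup>4\<close> produces
  \<open>\<zeta>\<close> to the power \<open>0 + 1 + 2 + 3\<close>.\<close>

lemma (in group) mult_pow_4_class_two:
  assumes carr: "g \<in> carrier G" "s \<in> carrier G" "\<zeta> \<in> carrier G"
    and sg: "s \<otimes> g = g \<otimes> s \<otimes> \<zeta>" and zg: "\<zeta> \<otimes> g = g \<otimes> \<zeta>" and zs: "\<zeta> \<otimes> s = s \<otimes> \<zeta>"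
    and z6: "\<zeta> [^] (6::nat) = \<one>"
  shows "(g \<otimes> s) [^] (4::nat) = g [^] (4::nat) \<otimes> s [^] (4::nat)"
proof -
  \<comment> \<open>With a trailing factor \<open>t\<close>, the rules also apply inside
    right-nested products.\<close>
  have sg': "s \<otimes> (g \<otimes> t) = g \<otimes> (s \<otimes> (\<zeta> \<otimes> t))" if "t \<in> carrier G" for t
    using carr that sg by (simp add: m_assoc flip: m_assoc[of s g])
  have zg': "\<zeta> \<otimes> (g \<otimes> t) = g \<otimes> (\<zeta> \<otimes> t)" if "t \<in> carrier G" for t
    using carr that zg by (metis m_assoc)
  have zs': "\<zeta> \<otimes> (s \<otimes> t) = s \<otimes> (\<zeta> \<otimes> t)" if "t \<in> carrier G" for t
    using carr that zs by (metis m_assoc)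
  \<comment> \<open>The six collected factors end up at the right in exactly this nested
    form.\<close>
  have "\<zeta> \<otimes> (\<zeta> \<otimes> (\<zeta> \<otimes> (\<zeta> \<otimes> (\<zeta> \<otimes> \<zeta>)))) = \<one>"
    using z6 carr by (simp add: numeral_eq_Suc m_assoc)
  then show ?thesis
    using carr by (simp add: numeral_eq_Suc m_assoc sg' zg' zs' zg zs)
qed

lemma (in group) commutes_inv:
  assumes "a \<in> carrier G" "b \<in> carrier G" "a \<otimes> b = b \<otimes> a"
  shows "inv a \<otimes> b = b \<otimes> inv a"
proof -
  have "inv a \<otimes> b = inv a \<otimes> (b \<otimes> a) \<otimes> inv a"
    using assms(1,2) by (simp add: m_assoc)
  also have "\<dots> = inv a \<otimes> (a \<otimes> b) \<otimes> inv a"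
    by (simp only: assms(3))
  also have "\<dots> = b \<otimes> inv a"
    using assms(1,2) by (simp flip: m_assoc)
  finally show ?thesis .
qed

lemma (in group) conj_by_eq_mult_commutator:
  "a \<in> carrier G \<Longrightarrow> b \<in> carrier G \<Longrightarrow> conj_by G b a = b \<otimes> commutator G b a"
  by (simp add: conj_by_def commutator_def m_assoc) (simp flip: m_assoc)

lemma (in group_hom) hom_commutator:
  assumes "a \<in> carrier G" "b \<in> carrier G"
  shows "h (commutator G a b) = commutator H (h a) (h b)"
  using assms by (simp add: commutator_def)

lemma (in group_hom) hom_conj_by:
  assumes "a \<in> carrier G" "b \<in> carrier G"
  shows "h (conj_by G b a) = conj_by H (h b) (h a)"
  using assms by (simp add: conj_by_def)

section \<open>Exponents modulo 81\<close>

text \<open>Reduces the congruences for exponents below to nine numerical checks.\<close>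

lemma mod_81_of_cong_7_mod_9:
  fixes \<alpha> :: int
  assumes "[\<alpha> = 7] (mod 9)"
  shows "\<alpha> mod 81 \<in> {7, 16, 25, 34, 43, 52, 61, 70, 79}"
proof -
  have "\<alpha> mod 81 mod 9 = 7"
    using assms by (simp add: cong_def mod_mod_cancel)
  moreover have "0 \<le> \<alpha> mod 81" "\<alpha> mod 81 < 81"
    by simp_all
  ultimately show ?thesis
    by simp presburger
qed

text \<open>Evaluates the exponent in \<open>conj_y_pow_x\<close> for n = 27. Such an \<alpha>
  generates the 27 units modulo 81 that are 1 modulo 3, and these add up to 27; the proof checks the
  nine residues.\<close>

lemma sum_powers_27:
  fixes \<alpha> :: int
  assumes "[\<alpha> = 7] (mod 9)"
  shows "[(\<Sum>i<27. \<alpha> ^ Suc i) = 27] (mod 81)"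
proof -
  have "[(\<Sum>i<27. \<alpha> ^ Suc i) = (\<Sum>i<27. (\<alpha> mod 81) ^ Suc i)] (mod 81)"
    by (intro cong_sum cong_pow) (simp add: cong_def)
  then have "(\<Sum>i<27. \<alpha> ^ Suc i) mod 81 = (\<Sum>i<27. (\<alpha> mod 81) ^ Suc i) mod 81"
    by (simp only: cong_def)
  also have "\<dots> = 27"
    using mod_81_of_cong_7_mod_9[OF assms] by (auto simp: lessThan_nat_numeral)
  finally show ?thesis
    by (simp add: cong_def)
qed

lemma power_27_cong:
  fixes \<alpha> :: int
  assumes "[\<alpha> = 7] (mod 9)"
  shows "[\<alpha> ^ 27 = 1] (mod 81)"
proof -
  have "[\<alpha> ^ 27 = (\<alpha> mod 81) ^ 27] (mod 81)"
    by (intro cong_pow) (simp add: cong_def)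
  then have "\<alpha> ^ 27 mod 81 = (\<alpha> mod 81) ^ 27 mod 81"
    by (simp only: cong_def)
  also have "\<dots> = 1"
    using mod_81_of_cong_7_mod_9[OF assms] by auto
  finally show ?thesis
    by (simp add: cong_def)
qed

text \<open>\<open>m\<close> will be the exponent of y in [x, y^4], and \<open>E\<close> that of x
  in [x^4, y^4]. Divisibility by 27 makes y^m and x^E commute with c; the last congruence is the
  source of the exponent 27 in \<open>y_pow_27\<close>.\<close>

lemma commutator_exponents_cong:
  fixes \<alpha> :: int
  assumes "[\<alpha> = 7] (mod 9)"
  defines "m \<equiv> 3 * \<alpha> ^ 4 - \<alpha> - \<alpha> ^ 2 - \<alpha> ^ 3"
    and "E \<equiv> \<alpha> ^ 4 + \<alpha> ^ 8 + \<alpha> ^ 12 - 3 * \<alpha> ^ 16"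
  shows "27 dvd m" and "27 dvd E" and "[4 * m + E = 27] (mod 81)"
proof -
  let ?r = "\<alpha> mod 81"
  have r: "[\<alpha> = ?r] (mod 81)"
    by (simp add: cong_def)
  have "[m = 3 * ?r ^ 4 - ?r - ?r ^ 2 - ?r ^ 3] (mod 81)"
    unfolding m_def by (intro cong_diff cong_mult cong_pow cong_refl r)
  then have m: "m mod 81 = (3 * ?r ^ 4 - ?r - ?r ^ 2 - ?r ^ 3) mod 81"
    by (simp only: cong_def)
  have "[E = ?r ^ 4 + ?r ^ 8 + ?r ^ 12 - 3 * ?r ^ 16] (mod 81)"
    unfolding E_def by (intro cong_add cong_diff cong_mult cong_pow cong_refl r)
  then have E: "E mod 81 = (?r ^ 4 + ?r ^ 8 + ?r ^ 12 - 3 * ?r ^ 16) mod 81"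
    by (simp only: cong_def)
  have "m mod 81 mod 27 = 0" "E mod 81 mod 27 = 0"
    unfolding m E using mod_81_of_cong_7_mod_9[OF assms(1)] by auto
  then show "27 dvd m" "27 dvd E"
    by (simp_all add: mod_mod_cancel mod_eq_0_iff_dvd)
  have "[4 * m + E = 4 * (m mod 81) + E mod 81] (mod 81)"
    by (intro cong_add cong_mult) (simp_all add: cong_def)
  then have "(4 * m + E) mod 81 = (4 * (m mod 81) + E mod 81) mod 81"
    by (simp only: cong_def)
  also have "\<dots> = 27"
    unfolding m E using mod_81_of_cong_7_mod_9[OF assms(1)] by auto
  finally show "[4 * m + E = 27] (mod 81)"
    by (simp add: cong_def)
qed

section \<open>The relations of \<open>J\<^sub>3(\<alpha>)\<close>\<close>

text \<open>The pair is not assumed to generate \<open>G\<close>, so (x, y^4) can be treated inside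
  the same group as (x, y).\<close>

locale macdonald_pair = group G for G (structure) +
  fixes \<alpha> :: int and x y
  assumes x_closed [simp]: "x \<in> carrier G" and y_closed [simp]: "y \<in> carrier G"
    and conj_x: "conj_by G x (commutator G x y) = x [^] \<alpha>"
    and conj_y: "conj_by G y (commutator G y x) = y [^] \<alpha>"
    and x_pow_81: "x [^] (81::nat) = \<one>" and y_pow_81: "y [^] (81::nat) = \<one>"
begin

abbreviation "c \<equiv> commutator G x y"

text \<open>The relations are symmetric, so every fact has a mirror image in which c becomes its
  inverse.\<close>

lemma swap: "macdonald_pair G \<alpha> y x"
  by unfold_locales (simp_all add: conj_x conj_y x_pow_81 y_pow_81)

lemma x_pow_cong: "[i = j] (mod 81) \<Longrightarrow> x [^] (i::int) = x [^] j"
  using int_pow_cong[OF x_closed x_pow_81] by simp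

lemma conj_x_pow: "conj_by G (x [^] i) (c [^] n) = x [^] (\<alpha> ^ n * i)" for n :: nat and i :: int
proof (induction n)
  case (Suc n)
  have "conj_by G (x [^] i) (c [^] Suc n) = conj_by G (conj_by G (x [^] i) (c [^] n)) c"
    by (simp add: conj_by_conj_by)
  also have "\<dots> = (x [^] \<alpha>) [^] (\<alpha> ^ n * i)"
    by (simp add: Suc conj_by_int_pow conj_x)
  finally show ?case
    by (simp add: int_pow_pow mult.assoc)
qed simp

lemma x_pow_c_pow: "x [^] i \<otimes> c [^] n = c [^] n \<otimes> x [^] (\<alpha> ^ n * i)" for n :: nat and i :: int
  using conj_x_pow by (subst conj_by_eq_iff[symmetric]) auto

text \<open>Since [y, x] is the inverse of c, the directions are opposite: c raises y to the power
  \<alpha> when it moves right past y, but x when it moves left past x.\<close>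

lemma c_pow_y_pow: "c [^] n \<otimes> y [^] i = y [^] (\<alpha> ^ n * i) \<otimes> c [^] n" for n :: nat and i :: int
proof -
  have "y [^] i \<otimes> inv (c [^] n) = inv (c [^] n) \<otimes> y [^] (\<alpha> ^ n * i)"
    using macdonald_pair.x_pow_c_pow[OF swap, of i n] by (simp add: nat_pow_inv flip: inv_commutator[of x y])
  then have "c [^] n \<otimes> (y [^] i \<otimes> inv (c [^] n)) \<otimes> c [^] n
      = c [^] n \<otimes> (inv (c [^] n) \<otimes> y [^] (\<alpha> ^ n * i)) \<otimes> c [^] n"
    by simp
  then show ?thesis
    by (simp add: m_assoc) (simp flip: m_assoc)
qed

text \<open>Conjugating \<open>y\<^sup>-\<^sup>n\<close> by \<open>x\<close> yields \<open>(c y\<^sup>-\<^sup>1)\<^sup>n\<close>, in which the factors \<open>c\<close> are moved to the right.\<close>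

lemma conj_y_pow_x:
  "conj_by G (y [^] (- int n)) x = y [^] (- (\<Sum>i<n. \<alpha> ^ Suc i)) \<otimes> c [^] n"
proof (induction n)
  case 0
  then show ?case by (simp add: conj_by_def)
next
  case (Suc n)
  have *: "conj_by G (inv y) x = c \<otimes> inv y"
    by (simp add: conj_by_def commutator_def m_assoc)
  have "conj_by G (y [^] (- int (Suc n))) x = conj_by G (inv y \<otimes> y [^] (- int n)) x"
    using int_pow_mult[of y "-1" "- int n"] by (simp add: int_pow_neg)
  also have "\<dots> = c \<otimes> inv y \<otimes> (y [^] (- (\<Sum>i<n. \<alpha> ^ Suc i)) \<otimes> c [^] n)"
    by (simp add: conj_by_mult Suc *)
  also have "\<dots> = c [^] (1::nat) \<otimes> y [^] (- 1 - (\<Sum>i<n. \<alpha> ^ Suc i)) \<otimes> c [^] n"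
    using int_pow_mult[of y "-1" "- (\<Sum>i<n. \<alpha> ^ Suc i)"] by (simp add: int_pow_neg m_assoc)
  also have "\<dots> = y [^] (\<alpha> * (- 1 - (\<Sum>i<n. \<alpha> ^ Suc i))) \<otimes> c [^] Suc n"
    unfolding c_pow_y_pow using nat_pow_mult[of c 1 n] by (simp add: m_assoc)
  \<comment> \<open>The factor \<alpha> shifts every index by one, and the -1 becomes the term of
    index 0.\<close>
  also have "\<alpha> * (- 1 - (\<Sum>i<n. \<alpha> ^ Suc i)) = - (\<Sum>i<Suc n. \<alpha> ^ Suc i)"
    by (simp add: sum.lessThan_Suc_shift sum_distrib_left algebra_simps del: sum.lessThan_Suc)
  finally show ?case .
qed

text \<open>[x, y^n] is the conjugate of y^-n by x, times y^n; moving y^n left past c^n multiplies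
  its exponent by \<alpha>^n.\<close>

lemma commutator_x_y_pow:
  "commutator G x (y [^] int n) = y [^] (int n * \<alpha> ^ n - (\<Sum>i<n. \<alpha> ^ Suc i)) \<otimes> c [^] n"
proof -
  have "commutator G x (y [^] int n) = conj_by G (y [^] (- int n)) x \<otimes> y [^] int n"
    by (simp add: commutator_def conj_by_def int_pow_neg)
  also have "\<dots> = y [^] (- (\<Sum>i<n. \<alpha> ^ Suc i)) \<otimes> (c [^] n \<otimes> y [^] int n)"
    unfolding conj_y_pow_x by (simp add: m_assoc)
  also have "\<dots> = y [^] (- (\<Sum>i<n. \<alpha> ^ Suc i)) \<otimes> y [^] (\<alpha> ^ n * int n) \<otimes> c [^] n"
    unfolding c_pow_y_pow by (simp add: m_assoc)
  finally show ?thesis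
    by (simp flip: int_pow_mult add: mult.commute)
qed

end

section \<open>Powers with exponent divisible by 27\<close>

locale macdonald_pair_7 = macdonald_pair +
  assumes \<alpha>_cong: "[\<alpha> = 7] (mod 9)"
begin

lemma swap_7: "macdonald_pair_7 G \<alpha> y x"
  by (intro macdonald_pair_7.intro swap macdonald_pair_7_axioms.intro \<alpha>_cong)

lemmas y_pow_cong = macdonald_pair.x_pow_cong[OF swap]

text \<open>Conjugation by c^27 raises x to the power \<alpha>^27, which is 1 modulo 81; the next
  lemma is the same for y.\<close>

lemma c_27_commutes_x: "x \<otimes> c [^] (27::nat) = c [^] (27::nat) \<otimes> x"
proof -
  have "x [^] (\<alpha> ^ 27) = x [^] (1::int)"
    by (rule x_pow_cong) (rule power_27_cong[OF \<alpha>_cong])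
  then show ?thesis
    using x_pow_c_pow[of 1 27] by simp
qed

lemma c_27_commutes_y: "c [^] (27::nat) \<otimes> y = y \<otimes> c [^] (27::nat)"
proof -
  have "y [^] (\<alpha> ^ 27) = y [^] (1::int)"
    by (rule y_pow_cong) (rule power_27_cong[OF \<alpha>_cong])
  then show ?thesis
    using c_pow_y_pow[of 27 1] by simp
qed

text \<open>\<alpha> is 1 modulo 3, and 81 = 27 * 3. Hence c fixes the powers of x and y with
  exponent divisible by 27.\<close>

lemma cong_mult_\<alpha>_power: "27 dvd j \<Longrightarrow> [\<alpha> ^ n * j = j] (mod 81)"
proof -
  assume "27 dvd j"
  then obtain k where j: "j = 27 * k" by blast
  have "[\<alpha> = 7] (mod 3)"
    using \<alpha>_cong by (rule cong_dvd_modulus) simp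
  then have "[\<alpha> = 1] (mod 3)"
    by (simp add: cong_def)
  then have "[\<alpha> ^ n = 1] (mod 3)"
    using cong_pow by fastforce
  then have "[27 * (\<alpha> ^ n * k) = 27 * (1 * k)] (mod (27 * 3))"
    by (intro cong_cmult_leftI cong_scalar_right)
  then show ?thesis
    by (simp add: j ac_simps)
qed

lemma x_pow_commutes_c_pow:
  "27 dvd j \<Longrightarrow> x [^] (j::int) \<otimes> c [^] (n::nat) = c [^] n \<otimes> x [^] j"
  unfolding x_pow_c_pow by (simp add: x_pow_cong[OF cong_mult_\<alpha>_power])

lemma c_pow_commutes_y_pow:
  "27 dvd j \<Longrightarrow> c [^] (n::nat) \<otimes> y [^] (j::int) = y [^] j \<otimes> c [^] n"
  unfolding c_pow_y_pow by (simp add: y_pow_cong[OF cong_mult_\<alpha>_power])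

text \<open>This is \<open>conj_y_pow_x\<close> for n = 27, inverted. It shows that c^27 measures
  how far y^27 is from commuting with x.\<close>

lemma conj_y_27: "conj_by G (y [^] (27::int)) x = y [^] (27::int) \<otimes> inv (c [^] (27::nat))"
proof -
  have "y [^] (- (\<Sum>i<27. \<alpha> ^ Suc i)) = y [^] (- 27 :: int)"
    by (intro y_pow_cong) (simp only: cong_minus_minus_iff sum_powers_27[OF \<alpha>_cong])
  then have "conj_by G (inv (y [^] (27::int))) x = inv (y [^] (27::int)) \<otimes> c [^] (27::nat)"
    using conj_y_pow_x[of 27] by (simp add: int_pow_neg)
  then have "inv (inv (conj_by G (y [^] (27::int)) x)) = inv (inv (y [^] (27::int)) \<otimes> c [^] (27::nat))"
    by (simp add: conj_by_inv)
  then show ?thesis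
    using c_pow_commutes_y_pow[of 27 27] by (simp add: inv_mult_group commutes_inv)
qed

text \<open>Cubing \<open>conj_y_27\<close> conjugates y^81 = 1 by x, and the factors y^27 and c^-27
  commute, so only c^-81 is left.\<close>

lemma c_pow_81: "c [^] (81::nat) = \<one>"
proof -
  let ?z = "inv (c [^] (27::nat))" and ?w = "y [^] (27::int)"
  have comm: "?w \<otimes> ?z = ?z \<otimes> ?w"
    using c_pow_commutes_y_pow[of 27 27] by (simp add: commutes_inv)
  have w3: "?w [^] (3::int) = \<one>"
    using y_pow_81 int_pow_int[of G y 81] by (simp add: int_pow_pow)
  have "conj_by G (?w [^] (3::int)) x = (?w \<otimes> ?z) [^] (3::int)"
    by (simp only: conj_by_int_pow conj_y_27 x_closed y_closed int_pow_closed)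
  also have "\<dots> = ?w [^] (3::int) \<otimes> ?z [^] (3::int)"
    using comm by (rule int_pow_mult_distrib) simp_all
  finally have "conj_by G (?w [^] (3::int)) x = ?w [^] (3::int) \<otimes> ?z [^] (3::int)" .
  then have "?z [^] (3::int) = \<one>"
    by (simp add: w3 conj_by_def)
  then have "inv (c [^] (81::nat)) = \<one>"
    by (simp add: int_pow_def2 nat_pow_inv nat_pow_pow)
  then show ?thesis
    by (simp add: inv_eq_1_iff)
qed


text \<open>Supplies the data for \<open>mult_pow_4_class_two\<close>. With j = 27 k, \<zeta> is
  c^(-27 k), whose sixth power is trivial by \<open>c_pow_81\<close>.\<close>

lemma y_pow_mult_x:
  assumes "27 dvd j"
  obtains \<zeta> where "\<zeta> \<in> carrier G" "y [^] (j::int) \<otimes> x = x \<otimes> y [^] j \<otimes> \<zeta>"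
    "\<zeta> \<otimes> x = x \<otimes> \<zeta>" "\<zeta> \<otimes> y = y \<otimes> \<zeta>" "\<zeta> \<otimes> c = c \<otimes> \<zeta>" "\<zeta> [^] (6::nat) = \<one>"
proof -
  obtain k where j: "j = 27 * k" using assms by blast
  let ?z = "c [^] (27::nat)" and ?w = "y [^] (27::int)"
  let ?\<zeta> = "?z [^] (- k)"
  have comm: "?\<zeta> \<otimes> b = b \<otimes> ?\<zeta>" if "b \<in> carrier G" "?z \<otimes> b = b \<otimes> ?z" for b
  proof -
    have "conj_by G ?z b = ?z"
      using that by (simp add: conj_by_eq_iff)
    then have "conj_by G ?\<zeta> b = ?\<zeta>"
      using that(1) by (simp add: conj_by_int_pow)
    then show ?thesis
      using that(1) by (simp add: conj_by_eq_iff)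
  qed
  have "?w \<otimes> inv ?z = inv ?z \<otimes> ?w"
    using c_pow_commutes_y_pow[of 27 27] by (simp add: commutes_inv)
  then have "(?w \<otimes> inv ?z) [^] k = ?w [^] k \<otimes> inv ?z [^] k"
    by (rule int_pow_mult_distrib) simp_all
  then have "conj_by G (?w [^] k) x = ?w [^] k \<otimes> ?\<zeta>"
    by (simp only: conj_by_int_pow conj_y_27 x_closed y_closed int_pow_closed int_pow_inv int_pow_neg
        nat_pow_closed commutator_closed)
  then have "conj_by G (y [^] j) x = y [^] j \<otimes> ?\<zeta>"
    by (simp add: j int_pow_pow)
  then have "y [^] j \<otimes> x = x \<otimes> y [^] j \<otimes> ?\<zeta>"
    by (simp add: conj_by_eq_iff m_assoc)
  moreover have "?\<zeta> [^] (6::nat) = \<one>"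
  proof -
    have "?\<zeta> [^] (6::nat) = c [^] (81 * (- 2 * k))"
      by (simp add: int_pow_pow flip: int_pow_int)
    also have "\<dots> = (c [^] (81::int)) [^] (- 2 * k)"
      by (simp only: int_pow_pow commutator_closed x_closed y_closed)
    finally show ?thesis
      using c_pow_81 int_pow_int[of G c 81] by simp
  qed
  ultimately show thesis
    using that[of ?\<zeta>] comm[of x] comm[of y] comm[of c] c_27_commutes_x c_27_commutes_y
    by (simp add: nat_pow_comm[of c 27 1, simplified])
qed

section \<open>The commutator of x^4 and y^4\<close>

definition "m = 3 * \<alpha> ^ 4 - \<alpha> - \<alpha> ^ 2 - \<alpha> ^ 3"
definition "E = \<alpha> ^ 4 + \<alpha> ^ 8 + \<alpha> ^ 12 - 3 * \<alpha> ^ 16"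

lemmas m_E_cong = commutator_exponents_cong[OF \<alpha>_cong, folded m_def E_def]

lemma commutator_x_y4: "commutator G x (y [^] (4::int)) = y [^] m \<otimes> c [^] (4::nat)"
  using commutator_x_y_pow[of 4]
  by (simp add: m_def lessThan_nat_numeral power2_eq_square power3_eq_cube power4_eq_xxxx algebra_simps)

text \<open>Conjugating x by y^4 gives x [x, y^4] = g s with g = x c^4 and s = y^m. As 27 divides m,
  s and g commute up to \<zeta>, so the fourth power of g s splits.\<close>

lemma commutator_x4_y4:
  "commutator G (x [^] (4::int)) (y [^] (4::int)) = c [^] (16::nat) \<otimes> (x [^] E \<otimes> y [^] (4 * m))"
proof -
  let ?g = "x \<otimes> c [^] (4::nat)" and ?s = "y [^] m"
  obtain \<zeta> where \<zeta>: "\<zeta> \<in> carrier G" "?s \<otimes> x = x \<otimes> ?s \<otimes> \<zeta>"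
    "\<zeta> \<otimes> x = x \<otimes> \<zeta>" "\<zeta> \<otimes> y = y \<otimes> \<zeta>" "\<zeta> \<otimes> c = c \<otimes> \<zeta>" "\<zeta> [^] (6::nat) = \<one>"
    using y_pow_mult_x[OF m_E_cong(1)] .
  have cs: "c [^] (4::nat) \<otimes> ?s = ?s \<otimes> c [^] (4::nat)"
    by (rule c_pow_commutes_y_pow[OF m_E_cong(1)])
  have \<zeta>c: "\<zeta> \<otimes> c [^] (4::nat) = c [^] (4::nat) \<otimes> \<zeta>"
    using \<zeta> group_commutes_pow[of c \<zeta> 4] by simp
  have \<zeta>s: "\<zeta> \<otimes> ?s = ?s \<otimes> \<zeta>"
  proof -
    have "conj_by G y \<zeta> = y"
      using \<zeta> by (simp add: conj_by_eq_iff)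
    then have "conj_by G ?s \<zeta> = ?s"
      using \<zeta>(1) by (simp add: conj_by_int_pow)
    then show ?thesis
      using \<zeta>(1) by (simp add: conj_by_eq_iff)
  qed
  have sg: "?s \<otimes> ?g = ?g \<otimes> ?s \<otimes> \<zeta>"
  proof -
    have "?s \<otimes> ?g = x \<otimes> ?s \<otimes> \<zeta> \<otimes> c [^] (4::nat)"
      by (simp add: \<zeta>(2) flip: m_assoc)
    also have "\<dots> = x \<otimes> (?s \<otimes> c [^] (4::nat)) \<otimes> \<zeta>"
      using \<zeta>(1) by (simp add: m_assoc \<zeta>c)
    also have "\<dots> = ?g \<otimes> ?s \<otimes> \<zeta>"
      using \<zeta>(1) by (simp add: m_assoc flip: cs)
    finally show ?thesis .
  qed
  have zg: "\<zeta> \<otimes> ?g = ?g \<otimes> \<zeta>"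
  proof -
    have "\<zeta> \<otimes> ?g = x \<otimes> (\<zeta> \<otimes> c [^] (4::nat))"
      using \<zeta>(1) by (simp add: \<zeta>(3) flip: m_assoc)
    then show ?thesis
      using \<zeta>(1) by (simp add: \<zeta>c m_assoc)
  qed
  have g: "?g = c [^] (4::nat) \<otimes> x [^] (\<alpha> ^ 4)"
    using x_pow_c_pow[of 1 4] by simp
  \<comment> \<open>The fourth power of g is found by squaring twice, with c collected on the
    left.\<close>
  have gg: "?g \<otimes> ?g = c [^] (8::nat) \<otimes> x [^] (\<alpha> ^ 8 + \<alpha> ^ 4)"
  proof -
    have "?g \<otimes> ?g = c [^] (4::nat) \<otimes> (x [^] (\<alpha> ^ 4) \<otimes> c [^] (4::nat)) \<otimes> x [^] (\<alpha> ^ 4)"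
      unfolding g by (simp add: m_assoc)
    also have "\<dots> = (c [^] (4::nat) \<otimes> c [^] (4::nat)) \<otimes> (x [^] (\<alpha> ^ 4 * \<alpha> ^ 4) \<otimes> x [^] (\<alpha> ^ 4))"
      unfolding x_pow_c_pow by (simp add: m_assoc)
    finally show ?thesis
      by (simp add: nat_pow_mult flip: int_pow_mult power_add)
  qed
  have g4: "?g [^] (4::nat) = c [^] (16::nat) \<otimes> x [^] (\<alpha> ^ 16 + \<alpha> ^ 12 + \<alpha> ^ 8 + \<alpha> ^ 4)"
  proof -
    have "?g [^] (4::nat) = (?g \<otimes> ?g) \<otimes> (?g \<otimes> ?g)"
      by (simp add: numeral_eq_Suc m_assoc)
    also have "\<dots> = c [^] (8::nat) \<otimes> (x [^] (\<alpha> ^ 8 + \<alpha> ^ 4) \<otimes> c [^] (8::nat)) \<otimes> x [^] (\<alpha> ^ 8 + \<alpha> ^ 4)"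
      unfolding gg by (simp add: m_assoc)
    also have "\<dots> = (c [^] (8::nat) \<otimes> c [^] (8::nat)) \<otimes> (x [^] (\<alpha> ^ 8 * (\<alpha> ^ 8 + \<alpha> ^ 4)) \<otimes> x [^] (\<alpha> ^ 8 + \<alpha> ^ 4))"
      unfolding x_pow_c_pow by (simp add: m_assoc)
    finally show ?thesis
      by (simp add: nat_pow_mult distrib_left add.assoc flip: int_pow_mult power_add)
  qed
  have "conj_by G x (y [^] (4::int)) = ?g \<otimes> ?s"
    by (simp add: conj_by_eq_mult_commutator commutator_x_y4 m_assoc cs)
  then have "conj_by G (x [^] (4::int)) (y [^] (4::int)) = (?g \<otimes> ?s) [^] (4::nat)"
    using conj_by_int_pow[of "y [^] (4::int)" x 4] int_pow_int[of G "?g \<otimes> ?s" 4] by simp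
  also have "\<dots> = ?g [^] (4::nat) \<otimes> ?s [^] (4::nat)"
    by (rule mult_pow_4_class_two[OF _ _ \<zeta>(1) sg zg \<zeta>s \<zeta>(6)]) simp_all
  also have "?s [^] (4::nat) = y [^] (4 * m)"
    by (simp add: int_pow_pow mult.commute flip: int_pow_int)
  finally have conj: "conj_by G (x [^] (4::int)) (y [^] (4::int))
    = c [^] (16::nat) \<otimes> (x [^] (\<alpha> ^ 16 + \<alpha> ^ 12 + \<alpha> ^ 8 + \<alpha> ^ 4) \<otimes> y [^] (4 * m))"
    by (simp add: g4 m_assoc)
  have "commutator G (x [^] (4::int)) (y [^] (4::int))
    = x [^] (- 4 :: int) \<otimes> conj_by G (x [^] (4::int)) (y [^] (4::int))"
    by (simp add: conj_by_def commutator_def m_assoc int_pow_neg)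
  also have "\<dots> = (x [^] (- 4 :: int) \<otimes> c [^] (16::nat)) \<otimes>
      (x [^] (\<alpha> ^ 16 + \<alpha> ^ 12 + \<alpha> ^ 8 + \<alpha> ^ 4) \<otimes> y [^] (4 * m))"
    by (simp add: conj m_assoc)
  \<comment> \<open>Moving x^-4 past c^16 multiplies its exponent by \<alpha>^16; with the summand
    \<alpha>^16 this leaves the -3 in \<open>E\<close>.\<close>
  also have "\<dots> = c [^] (16::nat) \<otimes> (x [^] (\<alpha> ^ 16 * - 4) \<otimes>
      x [^] (\<alpha> ^ 16 + \<alpha> ^ 12 + \<alpha> ^ 8 + \<alpha> ^ 4) \<otimes> y [^] (4 * m))"
    unfolding x_pow_c_pow by (simp add: m_assoc)
  also have "x [^] (\<alpha> ^ 16 * - 4) \<otimes> x [^] (\<alpha> ^ 16 + \<alpha> ^ 12 + \<alpha> ^ 8 + \<alpha> ^ 4) = x [^] E"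
    by (simp add: E_def algebra_simps flip: int_pow_mult)
  finally show ?thesis .
qed

text \<open>Multiplying the formula above by the one for \<open>[y\<^sup>4, x\<^sup>4]\<close> gives
  \<open>x\<^sup>E y\<^sup>4\<^sup>m y\<^sup>E x\<^sup>4\<^sup>m = 1\<close>, and \<open>4 m + E \<equiv> 27\<close> modulo \<open>81\<close>.\<close>

lemma y_pow_27: "y [^] (27::int) = x [^] (- 27 :: int)"
proof -
  let ?C = "c [^] (16::nat)"
  interpret S: macdonald_pair_7 G \<alpha> y x by (rule swap_7)
  \<comment> \<open>The mirror image of \<open>commutator_x4_y4\<close>: \<open>m\<close> and
    \<open>E\<close> depend only on \<alpha>, and c is inverted.\<close>
  have "commutator G (y [^] (4::int)) (x [^] (4::int)) = inv ?C \<otimes> (y [^] E \<otimes> x [^] (4 * m))"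
    using S.commutator_x4_y4 by (simp add: S.m_def m_def S.E_def E_def nat_pow_inv flip: inv_commutator[of x y])
  then have "?C \<otimes> (x [^] E \<otimes> y [^] (4 * m)) \<otimes> (inv ?C \<otimes> (y [^] E \<otimes> x [^] (4 * m))) = \<one>"
    using inv_commutator[of "x [^] (4::int)" "y [^] (4::int)"] by (metis commutator_x4_y4 commutator_closed int_pow_closed r_inv x_closed y_closed)
  \<comment> \<open>Both exponents are multiples of 27, so c^16 moves to the right and
    cancels.\<close>
  moreover have "?C \<otimes> (x [^] E \<otimes> y [^] (4 * m)) = x [^] E \<otimes> y [^] (4 * m) \<otimes> ?C"
  proof -
    have "?C \<otimes> (x [^] E \<otimes> y [^] (4 * m)) = x [^] E \<otimes> (?C \<otimes> y [^] (4 * m))"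
      using x_pow_commutes_c_pow[OF m_E_cong(2), of 16] by (simp flip: m_assoc)
    then show ?thesis
      using c_pow_commutes_y_pow[of "4 * m" 16] m_E_cong(1) by (simp add: m_assoc)
  qed
  ultimately have "x [^] E \<otimes> y [^] (4 * m) \<otimes> ?C \<otimes> (inv ?C \<otimes> (y [^] E \<otimes> x [^] (4 * m))) = \<one>"
    by simp
  moreover have "?C \<otimes> (inv ?C \<otimes> t) = t" if "t \<in> carrier G" for t
    using that by (simp flip: m_assoc)
  ultimately have "x [^] E \<otimes> (y [^] (4 * m) \<otimes> y [^] E) \<otimes> x [^] (4 * m) = \<one>"
    by (simp add: m_assoc)
  then have "x [^] E \<otimes> y [^] (4 * m + E) \<otimes> x [^] (4 * m) = \<one>"
    by (simp add: int_pow_mult)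
  then have "x [^] E \<otimes> y [^] (4 * m + E) = x [^] (- (4 * m))"
    by (simp add: inv_equality int_pow_neg inv_solve_right)
  then have "y [^] (4 * m + E) = x [^] (- E) \<otimes> x [^] (- (4 * m))"
    by (metis inv_solve_left int_pow_neg int_pow_closed x_closed y_closed)
  then have "y [^] (4 * m + E) = x [^] (- (4 * m + E))"
    by (simp flip: int_pow_mult add: add.commute)
  moreover have "y [^] (4 * m + E) = y [^] (27::int)" "x [^] (- (4 * m + E)) = x [^] (- 27 :: int)"
    using m_E_cong(3) by (auto intro!: y_pow_cong x_pow_cong simp only: cong_minus_minus_iff)
  ultimately show ?thesis by simp
qed

text \<open>By \<open>y_pow_27\<close>, such a power of y is a power of x.\<close>

lemma y_pow_commutes_x:
  assumes "27 dvd j"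
  shows "y [^] (j::int) \<otimes> x = x \<otimes> y [^] j"
proof -
  obtain k where j: "j = 27 * k" using assms by blast
  have "y [^] j = x [^] (- 27 * k)"
    using y_pow_27 by (simp add: j int_pow_pow flip: int_pow_pow[of y])
  then show ?thesis
    using int_pow_mult[of x "- 27 * k" 1] int_pow_mult[of x 1 "- 27 * k"] by (simp add: add.commute)
qed

text \<open>In [x, y^4] = y^m c^4 the factor y^m commutes with x, because 27 divides m, and with y.
  So only c^4 acts, on x directly and on y through its inverse.\<close>

lemma macdonald_pair_y4: "macdonald_pair_7 G (\<alpha> ^ 4) x (y [^] (4::int))"
proof
  let ?d = "commutator G x (y [^] (4::int))"
  have d: "?d = y [^] m \<otimes> c [^] (4::nat)"
    by (rule commutator_x_y4)
  have "conj_by G x ?d = conj_by G (conj_by G x (y [^] m)) (c [^] (4::nat))"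
    unfolding d by (simp add: conj_by_conj_by)
  also have "conj_by G x (y [^] m) = x"
    using y_pow_commutes_x[OF m_E_cong(1)] by (simp add: conj_by_eq_iff)
  finally show "conj_by G x ?d = x [^] (\<alpha> ^ 4)"
    using conj_x_pow[of 1 4] by simp
  have "inv ?d = inv (c [^] (4::nat)) \<otimes> y [^] (- m)"
    unfolding d by (simp add: inv_mult_group int_pow_neg)
  then have "conj_by G y (commutator G (y [^] (4::int)) x) = conj_by G (conj_by G y (inv (c [^] (4::nat)))) (y [^] (- m))"
    by (simp add: conj_by_conj_by flip: inv_commutator[of x])
  also have "conj_by G y (inv (c [^] (4::nat))) = y [^] (\<alpha> ^ 4)"
    using macdonald_pair.conj_x_pow[OF swap, of 1 4] by (simp add: nat_pow_inv flip: inv_commutator[of x y])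
  also have "conj_by G (y [^] (\<alpha> ^ 4)) (y [^] (- m)) = y [^] (\<alpha> ^ 4)"
    by (simp add: conj_by_eq_iff add.commute flip: int_pow_mult)
  finally show "conj_by G (y [^] (4::int)) (commutator G (y [^] (4::int)) x) = (y [^] (4::int)) [^] (\<alpha> ^ 4)"
    by (simp add: conj_by_int_pow int_pow_pow mult.commute)
  show "(y [^] (4::int)) [^] (81::nat) = \<one>"
    using y_pow_cong[of 324 0] by (simp add: int_pow_pow cong_def flip: int_pow_int)
  \<comment> \<open>7 has order 3 modulo 9.\<close>
  show "[\<alpha> ^ 4 = 7] (mod 9)"
    using cong_pow[OF \<alpha>_cong, of 4] by (simp add: cong_def)
qed (simp_all add: x_pow_81)

end

section \<open>Changing the exponent modulo 81 and iterating\<close>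

lemma macdonald_pair_cong:
  assumes "macdonald_pair G \<alpha> x y" "[\<alpha> = \<beta>] (mod 81)"
  shows "macdonald_pair G \<beta> x y"
proof -
  interpret macdonald_pair G \<alpha> x y by fact
  show ?thesis
    by unfold_locales
       (use conj_x conj_y x_pow_81 y_pow_81 x_pow_cong[OF assms(2)]
          macdonald_pair.x_pow_cong[OF swap assms(2)] in simp_all)
qed

lemma macdonald_pair_7_power_4_iterate:
  assumes "macdonald_pair_7 G \<alpha> x y"
  shows "macdonald_pair_7 G (\<alpha> ^ 4 ^ n) x (y [^]\<^bsub>G\<^esub> (4 ^ n :: int))"
proof (induction n)
  case 0
  interpret macdonald_pair_7 G \<alpha> x y by fact
  show ?case
    using assms by simp
next
  case (Suc n)
  interpret macdonald_pair_7 G \<alpha> x y by fact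
  show ?case
    using macdonald_pair_7.macdonald_pair_y4[OF Suc]
    by (simp add: int_pow_pow mult.commute flip: power_mult)
qed

section \<open>Homomorphisms out of presented groups\<close>

definition eval_word :: "('b, 'c) monoid_scheme \<Rightarrow> ('a \<Rightarrow> 'b) \<Rightarrow> 'a word \<Rightarrow> 'b" where
  "eval_word G f w =
     foldr (\<lambda>(a, e) g. (if e then f a else inv\<^bsub>G\<^esub> f a) \<otimes>\<^bsub>G\<^esub> g) w \<one>\<^bsub>G\<^esub>"

context group
begin

context
  fixes f :: "'g \<Rightarrow> 'a"
  assumes f_closed: "\<And>a. f a \<in> carrier G"
begin

lemma eval_word_closed: "eval_word G f w \<in> carrier G"
  by (induction w) (auto simp: eval_word_def f_closed)

lemma eval_word_append: "eval_word G f (u @ v) = eval_word G f u \<otimes> eval_word G f v"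
proof (induction u)
  case Nil
  then show ?case
    using eval_word_closed[of v] by (simp add: eval_word_def)
next
  case (Cons l u)
  then show ?case
    using eval_word_closed[of u] eval_word_closed[of v]
    by (cases l) (simp add: eval_word_def f_closed m_assoc)
qed

lemma eval_word_cong: "word_eq u v \<Longrightarrow> eval_word G f u = eval_word G f v"
proof (induction rule: word_eq_induct)
  case (step u v)
  then show ?case
  proof cases
    case (1 p a e q)
    have "eval_word G f [(a, e), (a, \<not> e)] = \<one>"
      by (cases e) (simp_all add: eval_word_def f_closed)
    then show ?thesis
      using eval_word_closed by (simp only: 1 eval_word_append l_one)
  qed
qed auto

text \<open>The map evaluates a representative word; \<open>eval_word_cong\<close> makes the choice
  irrelevant.\<close>

lemma free_group_hom_exists: "\<exists>h \<in> hom free_group G. \<forall>a. h (free_gen a) = f a"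
proof (intro bexI allI)
  let ?h = "\<lambda>U. eval_word G f (rep_free_elem U)"
  have h_abs: "?h (abs_free_elem w) = eval_word G f w" for w
    by (rule eval_word_cong)
       (simp flip: free_elem.abs_eq_iff add: Quotient3_abs_rep[OF Quotient3_free_elem])
  show "?h \<in> hom free_group G"
  proof (rule homI)
    fix U V :: "'g free_elem"
    show "?h (U \<otimes>\<^bsub>free_group\<^esub> V) = ?h U \<otimes> ?h V"
      by (induction U; induction V)
         (simp add: free_group_def free_mult.abs_eq h_abs eval_word_append)
  qed (rule eval_word_closed)
  show "?h (free_gen a) = f a" for a
    by (simp add: free_gen.abs_eq h_abs) (simp add: eval_word_def f_closed)
qed

end

lemma free_group_hom_eqI:
  fixes h h' :: "'g free_elem \<Rightarrow> 'a"
  assumes "h \<in> hom free_group G" "h' \<in> hom free_group G"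
    and gen: "\<And>a. h (free_gen a) = h' (free_gen a)"
  shows "h U = h' U"
proof (induction U)
  fix w
  interpret F: group "free_group :: 'g free_elem monoid" by (rule group_free_group)
  interpret h: group_hom free_group G h
    using assms by unfold_locales
  interpret h': group_hom free_group G h'
    using assms by unfold_locales
  have carr: "U \<in> carrier free_group" for U :: "'g free_elem"
    by (simp add: free_group_def)
  show "h (abs_free_elem w) = h' (abs_free_elem w)"
  proof (induction w)
    case Nil
    have "abs_free_elem [] = \<one>\<^bsub>free_group :: 'g free_elem monoid\<^esub>"
      by (simp add: free_group_def free_one.abs_eq)
    then show ?case by simp
  next
    case (Cons l w)
    obtain a e where l: "l = (a, e)" by (cases l)
    \<comment> \<open>Identifies a negative letter as the inverse of a generator, so agreement on
      generators covers all letters.\<close>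
    have "abs_free_elem [(a, False)] \<otimes>\<^bsub>free_group\<^esub> free_gen a = \<one>\<^bsub>free_group\<^esub>"
      using word_eq_inv_append[of "[(a, True)]"]
      by (simp add: free_group_def free_gen.abs_eq free_mult.abs_eq free_one.abs_eq
          free_elem.abs_eq_iff word_inv_def)
    then have "abs_free_elem [(a, False)] = inv\<^bsub>free_group\<^esub> free_gen a"
      by (intro F.inv_equality[symmetric] carr)
    then have "abs_free_elem [l] = (if e then free_gen a else inv\<^bsub>free_group\<^esub> free_gen a)"
      by (simp add: l free_gen.abs_eq)
    then have "h (abs_free_elem [l]) = h' (abs_free_elem [l])"
      using gen[of a] carr by simp
    moreover have "abs_free_elem (l # w) = abs_free_elem [l] \<otimes>\<^bsub>free_group\<^esub> abs_free_elem w"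
      by (simp add: free_group_def free_mult.abs_eq)
    ultimately show ?case
      using Cons.IH carr by simp
  qed
qed

end

definition presented_gen :: "'a free_elem set \<Rightarrow> 'a \<Rightarrow> 'a free_elem set" where
  "presented_gen R a = normal_closure free_group R #>\<^bsub>free_group\<^esub> free_gen a"

lemma normal_closure_free_group: "normal_closure free_group R \<lhd> free_group"
  by (intro group.normal_normal_closure group_free_group) (simp add: free_group_def)

lemma presented_group_proj_hom:
  "(\<lambda>U. normal_closure free_group R #>\<^bsub>free_group\<^esub> U) \<in> hom free_group (presented_group R)"
  unfolding presented_group_def by (rule normal.r_coset_hom_Mod[OF normal_closure_free_group])

lemma presented_group_proj_relator:
  assumes "r \<in> R"
  shows "normal_closure free_group R #>\<^bsub>free_group\<^esub> r = \<one>\<^bsub>presented_group R\<^esub>"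
proof -
  interpret N: normal "normal_closure free_group R" free_group
    by (rule normal_closure_free_group)
  have "r \<in> normal_closure free_group R"
    using assms by (auto simp: normal_closure_def)
  then show ?thesis
    by (simp add: presented_group_def N.rcos_const)
qed

text \<open>Von Dyck's theorem. \<open>rel\<close> speaks of an arbitrary homomorphism extending
  \<open>f\<close>, so relators can be evaluated without unfolding words.\<close>

lemma (in group) presented_group_hom:
  fixes f :: "'g \<Rightarrow> 'a"
  assumes f: "\<And>a. f a \<in> carrier G"
    and rel: "\<And>h r. \<lbrakk>h \<in> hom free_group G; \<And>a. h (free_gen a) = f a; r \<in> R\<rbrakk> \<Longrightarrow> h r = \<one>"
  obtains g where "g \<in> hom (presented_group R) G" "\<And>a. g (presented_gen R a) = f a"
proof -
  obtain h where h: "h \<in> hom free_group G" "\<And>a. h (free_gen a) = f a"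
    using free_group_hom_exists[of f, OF f] by auto
  interpret F: group "free_group :: 'g free_elem monoid" by (rule group_free_group)
  interpret h: group_hom free_group G h
    using h by unfold_locales
  \<comment> \<open>The kernel is one of the normal subgroups in the intersection.\<close>
  have "normal_closure free_group R \<subseteq> kernel free_group G h"
    using h.normal_kernel rel[OF h]
    by (auto simp: normal_closure_def kernel_def free_group_def)
  then obtain g where "g \<in> hom (free_group Mod normal_closure free_group R) G"
    "\<And>U. U \<in> carrier free_group \<Longrightarrow> g (normal_closure free_group R #>\<^bsub>free_group\<^esub> U) = h U"
    using h.FactGroup_universal_kernel[OF normal_closure_free_group] by metis
  then show thesis
    using that[of g] h(2) by (simp add: presented_group_def presented_gen_def free_group_def)
qed

lemma presented_group_hom_eqI:
  assumes "group G" "g \<in> hom (presented_group R) G" "g' \<in> hom (presented_group R) G"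
    and "\<And>a. g (presented_gen R a) = g' (presented_gen R a)"
    and U: "U \<in> carrier (presented_group R)"
  shows "g U = g' U"
proof -
  let ?p = "\<lambda>U. normal_closure free_group R #>\<^bsub>free_group\<^esub> U"
  obtain w where "U = ?p w"
    using U by (auto simp: presented_group_def carrier_FactGroup)
  moreover have "(g \<circ> ?p) w = (g' \<circ> ?p) w"
    by (rule group.free_group_hom_eqI[OF assms(1)
          hom_compose[OF presented_group_proj_hom assms(2)]
          hom_compose[OF presented_group_proj_hom assms(3)]])
       (simp add: assms(4)[unfolded presented_gen_def])
  ultimately show ?thesis
    by simp
qed

section \<open>Quotients by the center\<close>

lemma (in group) center_iso_image:
  assumes "\<phi> \<in> iso G H"
  shows "\<phi> ` center G = center H"
proof -
  have hom: "\<phi> \<in> hom G H" and bij: "bij_betw \<phi> (carrier G) (carrier H)"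
    using assms by (simp_all add: iso_def)
  have "\<phi> z \<in> center H \<longleftrightarrow> z \<in> center G" if z: "z \<in> carrier G" for z
  proof -
    have "\<phi> z \<in> center H \<longleftrightarrow> (\<forall>g\<in>carrier G. \<phi> z \<otimes>\<^bsub>H\<^esub> \<phi> g = \<phi> g \<otimes>\<^bsub>H\<^esub> \<phi> z)"
      using z hom_in_carrier[OF hom z]
      by (simp add: center_def flip: bij_betw_imp_surj_on[OF bij])
    also have "\<dots> \<longleftrightarrow> (\<forall>g\<in>carrier G. \<phi> (z \<otimes> g) = \<phi> (g \<otimes> z))"
      using z by (simp add: hom_mult[OF hom])
    also have "\<dots> \<longleftrightarrow> z \<in> center G"
      using z bij_betw_imp_inj_on[OF bij] by (auto simp: center_def inj_on_def)
    finally show ?thesis .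
  qed
  moreover have "center H \<subseteq> \<phi> ` carrier G"
    using bij_betw_imp_surj_on[OF bij] by (auto simp: center_def)
  moreover have "center G \<subseteq> carrier G"
    by (auto simp: center_def)
  ultimately show ?thesis
    by blast
qed

text \<open>First isomorphism theorem for \<phi> followed by the projection; the kernel is found
  with \<open>center_iso_image\<close>.\<close>

lemma Mod_center_iso:
  assumes "group G" "group H" "G \<cong> H"
  shows "G Mod center G \<cong> H Mod center H"
proof -
  interpret G: group G by fact
  interpret H: group H by fact
  interpret C: normal "center H" H by (rule H.normal_center)
  interpret Q: group "H Mod center H" by (rule C.factorgroup_is_group)
  obtain \<phi> where \<phi>: "\<phi> \<in> iso G H"
    using assms(3) by (auto simp: is_iso_def)
  have hom: "\<phi> \<in> hom G H" and bij: "bij_betw \<phi> (carrier G) (carrier H)"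
    using \<phi> by (simp_all add: iso_def)
  let ?\<psi> = "(\<lambda>a. center H #>\<^bsub>H\<^esub> a) \<circ> \<phi>"
  interpret \<psi>: group_hom G "H Mod center H" ?\<psi>
    using Group.hom_compose[OF hom C.r_coset_hom_Mod] by unfold_locales
  have surj: "?\<psi> ` carrier G = carrier (H Mod center H)"
    using bij_betw_imp_surj_on[OF bij] by (simp only: image_comp[symmetric] carrier_FactGroup)
  have ker: "kernel G (H Mod center H) ?\<psi> = center G"
  proof -
    have "center H #>\<^bsub>H\<^esub> \<phi> z = center H \<longleftrightarrow> z \<in> center G" if z: "z \<in> carrier G" for z
    proof -
      have "center H #>\<^bsub>H\<^esub> \<phi> z = center H \<longleftrightarrow> \<phi> z \<in> center H"
        using hom_in_carrier[OF hom z]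
          H.coset_join1[OF _ _ C.subgroup_axioms] H.coset_join2[OF _ C.subgroup_axioms]
        by blast
      also have "\<dots> \<longleftrightarrow> z \<in> center G"
        unfolding G.center_iso_image[OF \<phi>, symmetric]
        using bij_betw_imp_inj_on[OF bij] z by (auto simp: inj_on_def center_def)
      finally show ?thesis .
    qed
    moreover have "center G \<subseteq> carrier G"
      by (auto simp: center_def)
    ultimately show ?thesis
      by (auto simp: kernel_def)
  qed
  show ?thesis
    using \<psi>.FactGroup_iso[OF surj] unfolding ker .
qed

text \<open>The second center is the kernel of the two successive projections. This reduces
  quotients by it to two uses of \<open>Mod_center_iso\<close>.\<close>

lemma (in group) Mod_second_center_iso:
  "G Mod second_center G \<cong> (G Mod center G) Mod center (G Mod center G)"
proof -
  let ?Q = "G Mod center G"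
  interpret C: normal "center G" G by (rule normal_center)
  interpret Q: group ?Q by (rule C.factorgroup_is_group)
  interpret CQ: normal "center ?Q" ?Q by (rule Q.normal_center)
  interpret QQ: group "?Q Mod center ?Q" by (rule CQ.factorgroup_is_group)
  let ?\<psi> = "(\<lambda>a. center ?Q #>\<^bsub>?Q\<^esub> a) \<circ> (\<lambda>a. center G #> a)"
  interpret \<psi>: group_hom G "?Q Mod center ?Q" ?\<psi>
    using Group.hom_compose[OF C.r_coset_hom_Mod CQ.r_coset_hom_Mod] by unfold_locales
  have surj: "?\<psi> ` carrier G = carrier (?Q Mod center ?Q)"
    by (simp only: image_comp[symmetric] carrier_FactGroup)
  have ker: "kernel G (?Q Mod center ?Q) ?\<psi> = second_center G"
  proof -
    have "center ?Q #>\<^bsub>?Q\<^esub> (center G #> z) = center ?Q \<longleftrightarrow> center G #> z \<in> center ?Q"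
      if "z \<in> carrier G" for z
      using hom_in_carrier[OF C.r_coset_hom_Mod that]
        Q.coset_join1[OF _ _ CQ.subgroup_axioms] Q.coset_join2[OF _ CQ.subgroup_axioms]
      by blast
    then show ?thesis
      by (auto simp: kernel_def second_center_def)
  qed
  show ?thesis
    using \<psi>.FactGroup_iso[OF surj] unfolding ker .
qed

section \<open>The isomorphisms\<close>

abbreviation J3_gen :: "int \<Rightarrow> gen_xy \<Rightarrow> gen_xy free_elem set" where
  "J3_gen \<alpha> \<equiv> presented_gen (J3_relators \<alpha>)"

lemma macdonald_pair_J3: "macdonald_pair (J3 \<alpha>) \<alpha> (J3_gen \<alpha> Gen_x) (J3_gen \<alpha> Gen_y)"
proof -
  let ?F = "free_group :: gen_xy free_elem monoid"
  let ?h = "\<lambda>u. normal_closure ?F (J3_relators \<alpha>) #>\<^bsub>?F\<^esub> u"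
  let ?u = "free_gen Gen_x" and ?v = "free_gen Gen_y"
  interpret F: group ?F by (rule group_free_group)
  interpret J: group "J3 \<alpha>" unfolding J3_def by (rule group_presented_group)
  interpret h: group_hom ?F "J3 \<alpha>" ?h
    using presented_group_proj_hom[of "J3_relators \<alpha>"] by unfold_locales (simp add: J3_def)
  have carr [simp]: "u \<in> carrier ?F" for u
    by (simp add: free_group_def)
  have rel: "?h r = \<one>\<^bsub>J3 \<alpha>\<^esub>" if "r \<in> J3_relators \<alpha>" for r
    unfolding J3_def by (rule presented_group_proj_relator[OF that])
  have eq: "?h (a \<otimes>\<^bsub>?F\<^esub> inv\<^bsub>?F\<^esub> b) = \<one>\<^bsub>J3 \<alpha>\<^esub> \<Longrightarrow> ?h a = ?h b" for a b
    by (simp add: J.inv_solve_right')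
  have rels: "conj_by ?F ?u (commutator ?F ?u ?v) \<otimes>\<^bsub>?F\<^esub> inv\<^bsub>?F\<^esub> (?u [^]\<^bsub>?F\<^esub> \<alpha>) \<in> J3_relators \<alpha>"
    "conj_by ?F ?v (commutator ?F ?v ?u) \<otimes>\<^bsub>?F\<^esub> inv\<^bsub>?F\<^esub> (?v [^]\<^bsub>?F\<^esub> \<alpha>) \<in> J3_relators \<alpha>"
    "?u [^]\<^bsub>?F\<^esub> (81::nat) \<in> J3_relators \<alpha>" "?v [^]\<^bsub>?F\<^esub> (81::nat) \<in> J3_relators \<alpha>"
    by (simp_all add: J3_relators_def Let_def)
  show ?thesis
    using eq[OF rel[OF rels(1)]] eq[OF rel[OF rels(2)]] rel[OF rels(3)] rel[OF rels(4)]
    by unfold_locales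
       (simp_all add: presented_gen_def h.hom_conj_by h.hom_commutator h.hom_int_pow h.hom_nat_pow del: h.hom_mult)
qed

lemma (in macdonald_pair) J3_hom:
  obtains g where "g \<in> hom (J3 \<alpha>) G" "g (J3_gen \<alpha> Gen_x) = x" "g (J3_gen \<alpha> Gen_y) = y"
proof -
  define f where "f = case_gen_xy x y"
  have f [simp]: "f Gen_x = x" "f Gen_y = y"
    by (simp_all add: f_def)
  have "h r = \<one>" if h: "h \<in> hom free_group G" and gen: "\<And>a. h (free_gen a) = f a"
    and r: "r \<in> J3_relators \<alpha>" for h r
  proof -
    interpret F: group "free_group :: gen_xy free_elem monoid" by (rule group_free_group)
    interpret h: group_hom free_group G h
      using h by unfold_locales
    have [simp]: "u \<in> carrier free_group" for u :: "gen_xy free_elem"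
      by (simp add: free_group_def)
    show ?thesis
      using r by (auto simp: J3_relators_def Let_def h.hom_conj_by h.hom_commutator h.hom_int_pow
          h.hom_nat_pow gen conj_x conj_y x_pow_81 y_pow_81)
  qed
  moreover have "f a \<in> carrier G" for a
    by (cases a) simp_all
  ultimately show thesis
    using presented_group_hom[of f "J3_relators \<alpha>"] that f unfolding J3_def by metis
qed

text \<open>The exponent matters only modulo 27, where 4^27 is 1.\<close>

lemma power_4_27_cong:
  fixes \<alpha> :: int
  assumes "[\<alpha> = 7] (mod 9)"
  shows "[\<alpha> ^ 4 ^ 27 = \<alpha>] (mod 81)"
proof -
  \<comment> \<open>The large factor is (4^27 - 1) / 27.\<close>
  have "(4::nat) ^ 27 = 27 * 667199944795629 + 1"
    by simp
  then have "\<alpha> ^ 4 ^ 27 = (\<alpha> ^ 27) ^ 667199944795629 * \<alpha>"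
    by (simp only: power_add power_mult power_one_right)
  moreover have "[(\<alpha> ^ 27) ^ 667199944795629 * \<alpha> = 1 ^ 667199944795629 * \<alpha>] (mod 81)"
    by (intro cong_mult cong_pow power_27_cong assms cong_refl)
  ultimately show ?thesis
    by simp
qed

text \<open>The inverse of \<open>y \<mapsto> y\<close> to the power \<open>4\<^sup>n\<close> is \<open>y \<mapsto> y\<close> to the power \<open>4\<^sup>2\<^sup>7\<^sup>-\<^sup>n\<close>,
  because \<open>4\<close> has order \<open>27\<close> modulo \<open>81\<close>.\<close>

lemma J3_iso_power_4:
  assumes \<alpha>: "[\<alpha> = 7] (mod 9)" and \<beta>: "[\<beta> = \<alpha> ^ 4 ^ n] (mod 81)" and n: "n \<le> 27"
  shows "J3 \<beta> \<cong> J3 \<alpha>"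
proof -
  let ?x = "J3_gen \<alpha> Gen_x" and ?y = "J3_gen \<alpha> Gen_y"
  let ?x' = "J3_gen \<beta> Gen_x" and ?y' = "J3_gen \<beta> Gen_y"
  interpret A: macdonald_pair_7 "J3 \<alpha>" \<alpha> ?x ?y
    by (intro macdonald_pair_7.intro macdonald_pair_J3 macdonald_pair_7_axioms.intro \<alpha>)
  interpret An: macdonald_pair_7 "J3 \<alpha>" "\<alpha> ^ 4 ^ n" ?x "?y [^]\<^bsub>J3 \<alpha>\<^esub> (4 ^ n :: int)"
    by (rule macdonald_pair_7_power_4_iterate) unfold_locales
  have "[\<beta> = \<alpha> ^ 4 ^ n] (mod 9)"
    using \<beta> by (rule cong_dvd_modulus) simp
  then have \<beta>_7: "[\<beta> = 7] (mod 9)"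
    using An.\<alpha>_cong by (rule cong_trans)
  interpret B: macdonald_pair_7 "J3 \<beta>" \<beta> ?x' ?y'
    by (intro macdonald_pair_7.intro macdonald_pair_J3 macdonald_pair_7_axioms.intro \<beta>_7)
  interpret Bn: macdonald_pair_7 "J3 \<beta>" "\<beta> ^ 4 ^ (27 - n)" ?x' "?y' [^]\<^bsub>J3 \<beta>\<^esub> (4 ^ (27 - n) :: int)"
    by (rule macdonald_pair_7_power_4_iterate) unfold_locales
  \<comment> \<open>Polymorphic, because exponents of \<alpha> are naturals and those of y are
    integers.\<close>
  have pow_27: "(4::'c::comm_semiring_1) ^ n * 4 ^ (27 - n) = 4 ^ 27" "(4::'c) ^ (27 - n) * 4 ^ n = 4 ^ 27"
    using n by (simp_all flip: power_add)
  have "[\<beta> ^ 4 ^ (27 - n) = (\<alpha> ^ 4 ^ n) ^ 4 ^ (27 - n)] (mod 81)"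
    using \<beta> by (rule cong_pow)
  also have "(\<alpha> ^ 4 ^ n) ^ 4 ^ (27 - n) = \<alpha> ^ 4 ^ 27"
    by (simp only: pow_27 flip: power_mult)
  also have "[\<dots> = \<alpha>] (mod 81)"
    by (rule power_4_27_cong[OF \<alpha>])
  finally have \<beta>_pow: "[\<beta> ^ 4 ^ (27 - n) = \<alpha>] (mod 81)" .
  obtain f where f: "f \<in> hom (J3 \<beta>) (J3 \<alpha>)" "f ?x' = ?x" "f ?y' = ?y [^]\<^bsub>J3 \<alpha>\<^esub> (4 ^ n :: int)"
    using macdonald_pair.J3_hom[OF macdonald_pair_cong[OF An.macdonald_pair_axioms cong_sym[OF \<beta>]]] .
  obtain g where g: "g \<in> hom (J3 \<alpha>) (J3 \<beta>)" "g ?x = ?x'" "g ?y = ?y' [^]\<^bsub>J3 \<beta>\<^esub> (4 ^ (27 - n) :: int)"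
    using macdonald_pair.J3_hom[OF macdonald_pair_cong[OF Bn.macdonald_pair_axioms \<beta>_pow]] .
  interpret f: group_hom "J3 \<beta>" "J3 \<alpha>" f
    using f(1) by unfold_locales
  interpret g: group_hom "J3 \<alpha>" "J3 \<beta>" g
    using g(1) by unfold_locales
  have y27: "?y [^]\<^bsub>J3 \<alpha>\<^esub> (4 ^ 27 :: int) = ?y" "?y' [^]\<^bsub>J3 \<beta>\<^esub> (4 ^ 27 :: int) = ?y'"
    using A.y_pow_cong[of "4 ^ 27" 1] B.y_pow_cong[of "4 ^ 27" 1] by (simp_all add: cong_def)
  have gf: "g (f u) = u" if "u \<in> carrier (J3 \<beta>)" for u
  proof -
    \<comment> \<open>It suffices to compare on generators: x is fixed, and y goes to y^(4^27) =
      y.\<close>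
    have "(g \<circ> f) u = (\<lambda>u. u) u"
    proof (rule presented_group_hom_eqI[OF B.is_group])
      show "g \<circ> f \<in> hom (presented_group (J3_relators \<beta>)) (J3 \<beta>)"
        using hom_compose[OF f(1) g(1)] by (simp only: J3_def)
      show "(\<lambda>u. u) \<in> hom (presented_group (J3_relators \<beta>)) (J3 \<beta>)"
        by (simp add: J3_def hom_def)
      show "u \<in> carrier (presented_group (J3_relators \<beta>))"
        using that by (simp add: J3_def)
      show "(g \<circ> f) (J3_gen \<beta> a) = J3_gen \<beta> a" for a
        by (cases a) (simp_all only: comp_apply f g g.hom_int_pow A.y_closed B.int_pow_pow
            B.y_closed pow_27 y27)
    qed
    then show ?thesis by simp
  qed
  have fg: "f (g u) = u" if "u \<in> carrier (J3 \<alpha>)" for u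
  proof -
    have "(f \<circ> g) u = (\<lambda>u. u) u"
    proof (rule presented_group_hom_eqI[OF A.is_group])
      show "f \<circ> g \<in> hom (presented_group (J3_relators \<alpha>)) (J3 \<alpha>)"
        using hom_compose[OF g(1) f(1)] by (simp only: J3_def)
      show "(\<lambda>u. u) \<in> hom (presented_group (J3_relators \<alpha>)) (J3 \<alpha>)"
        by (simp add: J3_def hom_def)
      show "u \<in> carrier (presented_group (J3_relators \<alpha>))"
        using that by (simp add: J3_def)
      show "(f \<circ> g) (J3_gen \<alpha> a) = J3_gen \<alpha> a" for a
        by (cases a) (simp_all only: comp_apply f g f.hom_int_pow B.y_closed A.int_pow_pow
            A.y_closed pow_27 y27)
    qed
    then show ?thesis by simp
  qed
  have "bij_betw f (carrier (J3 \<beta>)) (carrier (J3 \<alpha>))"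
    by (rule bij_betwI[where g = g]) (auto simp: gf fg)
  then show ?thesis
    using f(1) by (intro is_isoI isoI)
qed

text \<open>7 has order 27 modulo 81, and modulo 27 the powers of 4 are the nine residues that are 1
  modulo 3. Hence n = 0, ..., 8 already give all nine values.\<close>

lemma ex_power_of_7_cong:
  fixes \<alpha> :: int
  assumes "[\<alpha> = 7] (mod 9)"
  shows "\<exists>n\<le>27. [\<alpha> = 7 ^ 4 ^ n] (mod 81)"
proof -
  \<comment> \<open>Residues are raised to the fourth power one step at a time, which avoids the
    huge numbers \<open>7 ^ 4 ^ n\<close>.\<close>
  have step: "[7 ^ 4 ^ Suc n = s] (mod 81)" if "[7 ^ 4 ^ n = r] (mod 81)" "[r ^ 4 = s] (mod 81)"
    for n and r s :: int
    using cong_trans[OF cong_pow[OF that(1), of 4] that(2)]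
    by (simp add: mult.commute flip: power_mult)
  have reach: ?thesis if "[7 ^ 4 ^ n = r] (mod 81)" "n \<le> 27" "\<alpha> mod 81 = r" for n r
    using that by (intro exI[of _ n]) (simp add: cong_def)
  have p0: "[(7::int) ^ 4 ^ 0 = 7] (mod 81)" by simp
  have p1: "[(7::int) ^ 4 ^ Suc 0 = 52] (mod 81)"
    by (rule step[OF p0]) (simp add: cong_def)
  have p2: "[(7::int) ^ 4 ^ Suc (Suc 0) = 70] (mod 81)"
    by (rule step[OF p1]) (simp add: cong_def)
  have p3: "[(7::int) ^ 4 ^ Suc (Suc (Suc 0)) = 61] (mod 81)"
    by (rule step[OF p2]) (simp add: cong_def)
  have p4: "[(7::int) ^ 4 ^ Suc (Suc (Suc (Suc 0))) = 25] (mod 81)"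
    by (rule step[OF p3]) (simp add: cong_def)
  have p5: "[(7::int) ^ 4 ^ Suc (Suc (Suc (Suc (Suc 0)))) = 43] (mod 81)"
    by (rule step[OF p4]) (simp add: cong_def)
  have p6: "[(7::int) ^ 4 ^ Suc (Suc (Suc (Suc (Suc (Suc 0))))) = 34] (mod 81)"
    by (rule step[OF p5]) (simp add: cong_def)
  have p7: "[(7::int) ^ 4 ^ Suc (Suc (Suc (Suc (Suc (Suc (Suc 0)))))) = 79] (mod 81)"
    by (rule step[OF p6]) (simp add: cong_def)
  have p8: "[(7::int) ^ 4 ^ Suc (Suc (Suc (Suc (Suc (Suc (Suc (Suc 0))))))) = 16] (mod 81)"
    by (rule step[OF p7]) (simp add: cong_def)
  show ?thesis
    using mod_81_of_cong_7_mod_9[OF assms] reach[OF p0] reach[OF p1] reach[OF p2] reach[OF p3]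
      reach[OF p4] reach[OF p5] reach[OF p6] reach[OF p7] reach[OF p8]
    by (elim insertE) simp_all
qed

theorem theoremC:
  fixes l :: int
  assumes "[l = -1] (mod 3)"
  shows "J3 (1 + 3 * l) \<cong> J3 7 \<and> H3 (1 + 3 * l) \<cong> H3 7 \<and> K3 (1 + 3 * l) \<cong> K3 7"
proof -
  let ?\<alpha> = "1 + 3 * l"
  \<comment> \<open>Tripling turns the modulus 3 into 9, and 1 - 3 is 7 modulo 9.\<close>
  have "[3 * l = 3 * (- 1)] (mod (3 * 3))"
    using assms by (rule cong_cmult_leftI)
  then have "[1 + 3 * l = 1 + 3 * (- 1)] (mod 9)"
    by (intro cong_add) simp_all
  then have "[?\<alpha> = 7] (mod 9)"
    by (simp add: cong_def)
  then obtain n where "n \<le> 27" "[?\<alpha> = 7 ^ 4 ^ n] (mod 81)"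
    using ex_power_of_7_cong by blast
  then have J: "J3 ?\<alpha> \<cong> J3 7"
    by (intro J3_iso_power_4[of 7 _ n]) simp_all
  have gJ: "group (J3 \<beta>)" for \<beta>
    unfolding J3_def by (rule group_presented_group)
  have gH: "group (H3 \<beta>)" for \<beta>
    unfolding H3_def by (rule normal.factorgroup_is_group[OF group.normal_center[OF gJ]])
  have H: "H3 ?\<alpha> \<cong> H3 7"
    unfolding H3_def by (rule Mod_center_iso[OF gJ gJ J])
  have K: "K3 \<beta> \<cong> H3 \<beta> Mod center (H3 \<beta>)" for \<beta>
    unfolding K3_def H3_def by (rule group.Mod_second_center_iso[OF gJ])
  have "group (K3 7)"
    unfolding K3_def by (rule normal.factorgroup_is_group[OF group.normal_second_center[OF gJ]])
  then have "H3 7 Mod center (H3 7) \<cong> K3 7"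
    by (rule group.iso_sym[OF _ K])
  then have "K3 ?\<alpha> \<cong> K3 7"
    by (rule iso_trans[OF iso_trans[OF K Mod_center_iso[OF gH gH H]]])
  with J H show ?thesis by blast
qed

end
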